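(* Let $\{f_\beta:\beta\in\mathcal{B}\}$ be a $p$-parameter exponential family of densities $f_\beta(\hat\beta)=e^{\alpha'\hat\beta-\psi(\alpha)}f_0(\hat\beta)$, where $\alpha$ is the canonical parameter vector corresponding to the expectation parameter $\beta=E_\alpha\{\hat\beta\}$. Let $\hat\beta\in\mathcal{B}$ be a fixed observed value of the sufficient statistic and let $\beta\in\mathcal{B}$, with $f_0(\beta)>0$ and $f_0(\hat\beta)>0$. Then the conversion factor $R(\beta)=f_\beta(\hat\beta)/f_{\hat\beta}(\beta)$ equals $$R(\beta)=\xi(\beta)\,e^{\Delta(\beta)},$$ where $$\xi(\beta)=\frac{f_{\hat\beta}(\hat\beta)}{f_\beta(\beta)}\qquad\text{and}\qquad \Delta(\beta)=\frac{D(\beta,\hat\beta)-D(\hat\beta,\beta)}{2}.$$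
   Context: The densities are with respect to a fixed dominating measure on $\mathbb{R}^p$; $\psi$ is the cumulant generating function (normalizer), and the canonical parameter $\alpha$ and the expectation parameter $\beta=E_\alpha\{\hat\beta\}$ are in one-to-one correspondence; $\mathcal{B}$ is the space of possible expectation vectors. Here $f_\beta(\hat\beta)$ denotes the density with expectation parameter $\beta$ evaluated at the point $\hat\beta$, and $f_{\hat\beta}(\beta)$ the density with expectation parameter $\hat\beta$ evaluated at the point $\beta$. The deviance between two members of the family is $D(\beta_1,\beta_2)=2E_{\beta_1}\{\log(f_{\beta_1}(\hat\beta)/f_{\beta_2}(\hat\beta))\}$, the expectation being over $\hat\beta\sim f_{\beta_1}$; equivalently, if $\alpha_1,\alpha_2$ correspond to $\beta_1,\beta_2$, $D(\beta_1,\beta_2)/2=(\alpha_1-\alpha_2)'\beta_1-(\psi(\alpha_1)-\psi(\alpha_2))$. *)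

theory Defs
  imports "HOL-Probability.Probability"
begin

text \<open>
  Exponential families on \<open>\<real>\<^sup>p\<close>: \<open>M\<close> is the dominating measure, \<open>f0\<close> the carrier, \<open>A\<close> the set of
  canonical parameters. Names ending in \<open>_can\<close> are indexed by the canonical
  parameter, the others by the expectation parameter.
\<close>

definition cumulant_gf :: "(real^'p) measure \<Rightarrow> (real^'p \<Rightarrow> real) \<Rightarrow> real^'p \<Rightarrow> real" where
  "cumulant_gf M f0 \<alpha> = ln (LINT x|M. exp (\<alpha> \<bullet> x) * f0 x)"

definition density_can ::
    "(real^'p) measure \<Rightarrow> (real^'p \<Rightarrow> real) \<Rightarrow> real^'p \<Rightarrow> real^'p \<Rightarrow> real" where
  "density_can M f0 \<alpha> x = exp (\<alpha> \<bullet> x - cumulant_gf M f0 \<alpha>) * f0 x"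

definition law_can ::
    "(real^'p) measure \<Rightarrow> (real^'p \<Rightarrow> real) \<Rightarrow> real^'p \<Rightarrow> (real^'p) measure" where
  "law_can M f0 \<alpha> = density M (\<lambda>x. ennreal (density_can M f0 \<alpha> x))"

definition mean_can ::
    "(real^'p) measure \<Rightarrow> (real^'p \<Rightarrow> real) \<Rightarrow> real^'p \<Rightarrow> real^'p" where
  "mean_can M f0 \<alpha> = (LINT x|law_can M f0 \<alpha>. x)"

text \<open>
  \<open>A\<close> may be any set of parameters at which the normalizer and the mean exist; neither openness of
  \<open>A\<close> nor \<open>A\<close> being the full natural parameter space is required. The carrier \<open>f0\<close> need not itself
  integrate to one.
\<close>

locale exponential_family =
  fixes M :: "(real^'p) measure" and f0 :: "real^'p \<Rightarrow> real" and A :: "(real^'p) set"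
  assumes sets_dominating: "sets M = sets borel"
    and carrier_measurable: "f0 \<in> borel_measurable M"
    and carrier_nonneg: "\<And>x. f0 x \<ge> 0"
    and normalizer_integrable: "\<And>\<alpha>. \<alpha> \<in> A \<Longrightarrow> integrable M (\<lambda>x. exp (\<alpha> \<bullet> x) * f0 x)"
    and normalizer_pos: "\<And>\<alpha>. \<alpha> \<in> A \<Longrightarrow> (LINT x|M. exp (\<alpha> \<bullet> x) * f0 x) > 0"
    and mean_exists: "\<And>\<alpha>. \<alpha> \<in> A \<Longrightarrow> integrable (law_can M f0 \<alpha>) (\<lambda>x. x)"
    and mean_inj: "inj_on (mean_can M f0) A"

definition expectation_space ::
    "(real^'p) measure \<Rightarrow> (real^'p \<Rightarrow> real) \<Rightarrow> (real^'p) set \<Rightarrow> (real^'p) set" where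
  "expectation_space M f0 A = mean_can M f0 ` A"

definition canonical_param ::
    "(real^'p) measure \<Rightarrow> (real^'p \<Rightarrow> real) \<Rightarrow> (real^'p) set \<Rightarrow> real^'p \<Rightarrow> real^'p" where
  "canonical_param M f0 A = inv_into A (mean_can M f0)"

definition ef_density ::
    "(real^'p) measure \<Rightarrow> (real^'p \<Rightarrow> real) \<Rightarrow> (real^'p) set \<Rightarrow> real^'p \<Rightarrow> real^'p \<Rightarrow> real" where
  "ef_density M f0 A \<beta> = density_can M f0 (canonical_param M f0 A \<beta>)"

definition ef_law ::
    "(real^'p) measure \<Rightarrow> (real^'p \<Rightarrow> real) \<Rightarrow> (real^'p) set \<Rightarrow> real^'p \<Rightarrow> (real^'p) measure" where
  "ef_law M f0 A \<beta> = density M (\<lambda>x. ennreal (ef_density M f0 A \<beta> x))"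

text \<open>Where \<open>f0\<close> vanishes the log-ratio is the junk value \<open>ln (0 / 0) = 0\<close>; that set is null under
  every member of the family.\<close>

definition deviance ::
    "(real^'p) measure \<Rightarrow> (real^'p \<Rightarrow> real) \<Rightarrow> (real^'p) set \<Rightarrow> real^'p \<Rightarrow> real^'p \<Rightarrow> real" where
  "deviance M f0 A \<beta>\<^sub>1 \<beta>\<^sub>2 =
     2 * (LINT x|ef_law M f0 A \<beta>\<^sub>1. ln (ef_density M f0 A \<beta>\<^sub>1 x / ef_density M f0 A \<beta>\<^sub>2 x))"

definition conversion_factor ::
    "(real^'p) measure \<Rightarrow> (real^'p \<Rightarrow> real) \<Rightarrow> (real^'p) set \<Rightarrow> real^'p \<Rightarrow> real^'p \<Rightarrow> real" where
  "conversion_factor M f0 A \<beta>hat \<beta> = ef_density M f0 A \<beta> \<beta>hat / ef_density M f0 A \<beta>hat \<beta>"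

definition xi_factor ::
    "(real^'p) measure \<Rightarrow> (real^'p \<Rightarrow> real) \<Rightarrow> (real^'p) set \<Rightarrow> real^'p \<Rightarrow> real^'p \<Rightarrow> real" where
  "xi_factor M f0 A \<beta>hat \<beta> = ef_density M f0 A \<beta>hat \<beta>hat / ef_density M f0 A \<beta> \<beta>"

definition deviance_diff ::
    "(real^'p) measure \<Rightarrow> (real^'p \<Rightarrow> real) \<Rightarrow> (real^'p) set \<Rightarrow> real^'p \<Rightarrow> real^'p \<Rightarrow> real" where
  "deviance_diff M f0 A \<beta>hat \<beta> = (deviance M f0 A \<beta> \<beta>hat - deviance M f0 A \<beta>hat \<beta>) / 2"

end

theory Submission
  imports Defs
begin

text \<open>
  The deviance is the expectation of a log-ratio that is affine in the sufficient statistic, so it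
  equals \<open>2 ((\<alpha>\<^sub>1 - \<alpha>\<^sub>2) \<bullet> \<beta>\<^sub>1 - (\<psi> \<alpha>\<^sub>1 - \<psi> \<alpha>\<^sub>2))\<close>. Substituting this for both deviances, the exponents
  on the two sides agree identically, and the carrier contributes \<open>f0 \<beta>hat / f0 \<beta>\<close> to each side.
\<close>

context exponential_family
begin

lemma density_can_measurable [measurable]: "density_can M f0 \<alpha> \<in> borel_measurable M"
proof -
  have [measurable]: "f0 \<in> borel_measurable M" by (rule carrier_measurable)
  \<comment> \<open>\<open>M\<close> is Borel only through \<open>sets_dominating\<close>, so
    measurability of the linear form is carried over from \<open>borel\<close>.\<close>
  have "(\<lambda>x. \<alpha> \<bullet> x) \<in> borel_measurable M"
    unfolding measurable_cong_sets[OF sets_dominating refl] by simp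
  then show ?thesis
    unfolding density_can_def[abs_def] by measurable
qed

lemma density_can_nonneg: "density_can M f0 \<alpha> x \<ge> 0"
  by (simp add: density_can_def carrier_nonneg)

lemma density_can_pos_iff: "density_can M f0 \<alpha> x > 0 \<longleftrightarrow> f0 x > 0"
  by (simp add: density_can_def zero_less_mult_iff)

text \<open>Separates the factor that is constant in \<open>x\<close>, so that the locale
  assumptions on the normalizer transfer to the density by linearity of the integral.\<close>

lemma density_can_altdef:
  "density_can M f0 \<alpha> x = exp (- cumulant_gf M f0 \<alpha>) * (exp (\<alpha> \<bullet> x) * f0 x)"
  by (simp add: density_can_def exp_diff exp_minus field_simps)

lemma integrable_density_can:
  assumes "\<alpha> \<in> A"
  shows "integrable M (density_can M f0 \<alpha>)"
  unfolding density_can_altdef[abs_def] using normalizer_integrable[OF assms] by simp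

text \<open>With Z the normalizing integral, Z > 0 makes \<open>ln\<close> a genuine logarithm, so
  the constant factor exp (- ln Z) is 1 / Z.\<close>

lemma integral_density_can:
  assumes "\<alpha> \<in> A"
  shows "(LINT x|M. density_can M f0 \<alpha> x) = 1"
  using normalizer_pos[OF assms]
  by (simp add: density_can_altdef cumulant_gf_def exp_minus)

lemma prob_space_law_can:
  assumes "\<alpha> \<in> A"
  shows "prob_space (law_can M f0 \<alpha>)"
proof
  have "emeasure (law_can M f0 \<alpha>) (space (law_can M f0 \<alpha>))
      = (\<integral>\<^sup>+x. ennreal (density_can M f0 \<alpha> x) \<partial>M)"
    unfolding law_can_def by (subst emeasure_density) (auto intro!: nn_integral_cong)
  also have "\<dots> = 1"
    using integrable_density_can[OF assms] integral_density_can[OF assms]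
    by (subst nn_integral_eq_integral) (auto simp: density_can_nonneg)
  finally show "emeasure (law_can M f0 \<alpha>) (space (law_can M f0 \<alpha>)) = 1" .
qed

text \<open>A null set of a measure with a density may include all points where that density is
  zero, and here these are the zeros of \<open>f0\<close>. This disposes of the junk values of the
  log-ratio.\<close>

lemma AE_law_can_carrier_pos: "AE x in law_can M f0 \<alpha>. f0 x > 0"
  unfolding law_can_def by (subst AE_density) (auto simp: density_can_pos_iff)

text \<open>A positive carrier cancels from the quotient, leaving a single exponential. At a zero of
  \<open>f0\<close> the left side would be 0, whatever the affine expression on the right.\<close>

lemma ln_density_can_ratio:
  assumes "f0 x > 0"
  shows "ln (density_can M f0 \<alpha>\<^sub>1 x / density_can M f0 \<alpha>\<^sub>2 x)
    = (\<alpha>\<^sub>1 - \<alpha>\<^sub>2) \<bullet> x - (cumulant_gf M f0 \<alpha>\<^sub>1 - cumulant_gf M f0 \<alpha>\<^sub>2)"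
proof -
  have "density_can M f0 \<alpha>\<^sub>1 x / density_can M f0 \<alpha>\<^sub>2 x
      = exp ((\<alpha>\<^sub>1 - \<alpha>\<^sub>2) \<bullet> x - (cumulant_gf M f0 \<alpha>\<^sub>1 - cumulant_gf M f0 \<alpha>\<^sub>2))"
    using assms by (simp add: density_can_def inner_diff_left flip: exp_diff)
  then show ?thesis by simp
qed

lemma integral_ln_density_can_ratio:
  assumes "\<alpha>\<^sub>1 \<in> A"
  shows "(LINT x|law_can M f0 \<alpha>\<^sub>1. ln (density_can M f0 \<alpha>\<^sub>1 x / density_can M f0 \<alpha>\<^sub>2 x))
    = (\<alpha>\<^sub>1 - \<alpha>\<^sub>2) \<bullet> mean_can M f0 \<alpha>\<^sub>1 - (cumulant_gf M f0 \<alpha>\<^sub>1 - cumulant_gf M f0 \<alpha>\<^sub>2)"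
proof -
  interpret P: prob_space "law_can M f0 \<alpha>\<^sub>1"
    by (rule prob_space_law_can[OF assms])
  have int: "integrable (law_can M f0 \<alpha>\<^sub>1) (\<lambda>x. x)"
    by (rule mean_exists[OF assms])
  have [measurable]: "density_can M f0 \<alpha> \<in> borel_measurable (law_can M f0 \<alpha>\<^sub>1)" for \<alpha>
    using density_can_measurable by (simp add: law_can_def)
  have "(LINT x|law_can M f0 \<alpha>\<^sub>1. ln (density_can M f0 \<alpha>\<^sub>1 x / density_can M f0 \<alpha>\<^sub>2 x))
      = (LINT x|law_can M f0 \<alpha>\<^sub>1.
          (\<alpha>\<^sub>1 - \<alpha>\<^sub>2) \<bullet> x - (cumulant_gf M f0 \<alpha>\<^sub>1 - cumulant_gf M f0 \<alpha>\<^sub>2))"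
  proof (rule integral_cong_AE)
    show "(\<lambda>x. (\<alpha>\<^sub>1 - \<alpha>\<^sub>2) \<bullet> x - (cumulant_gf M f0 \<alpha>\<^sub>1 - cumulant_gf M f0 \<alpha>\<^sub>2))
        \<in> borel_measurable (law_can M f0 \<alpha>\<^sub>1)"
      \<comment> \<open>Integrability of the identity supplies its measurability with respect to the
        law.\<close>
      using borel_measurable_integrable[OF int] by measurable
    show "AE x in law_can M f0 \<alpha>\<^sub>1. ln (density_can M f0 \<alpha>\<^sub>1 x / density_can M f0 \<alpha>\<^sub>2 x)
        = (\<alpha>\<^sub>1 - \<alpha>\<^sub>2) \<bullet> x - (cumulant_gf M f0 \<alpha>\<^sub>1 - cumulant_gf M f0 \<alpha>\<^sub>2)"
      using AE_law_can_carrier_pos by eventually_elim (rule ln_density_can_ratio)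
  qed measurable
  also have "\<dots> = (\<alpha>\<^sub>1 - \<alpha>\<^sub>2) \<bullet> mean_can M f0 \<alpha>\<^sub>1
      - (cumulant_gf M f0 \<alpha>\<^sub>1 - cumulant_gf M f0 \<alpha>\<^sub>2)"
    \<comment> \<open>The inner product passes through the vector-valued integral because the mean
      exists, and the constant is unchanged because the total mass is 1.\<close>
    using int by (simp add: mean_can_def P.prob_space)
  finally show ?thesis .
qed

lemma canonical_param_mean_can:
  assumes "\<alpha> \<in> A"
  shows "canonical_param M f0 A (mean_can M f0 \<alpha>) = \<alpha>"
  unfolding canonical_param_def by (rule inv_into_f_f[OF mean_inj assms])

lemma ef_density_mean_can:
  assumes "\<alpha> \<in> A"
  shows "ef_density M f0 A (mean_can M f0 \<alpha>) = density_can M f0 \<alpha>"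
  by (simp add: ef_density_def canonical_param_mean_can[OF assms])

lemma ef_law_mean_can:
  assumes "\<alpha> \<in> A"
  shows "ef_law M f0 A (mean_can M f0 \<alpha>) = law_can M f0 \<alpha>"
  by (simp add: ef_law_def law_can_def ef_density_mean_can[OF assms])

text \<open>Twice the Kullback-Leibler divergence in closed form; indexing both members by canonical
  parameters avoids the inverse of the mean map.\<close>

lemma deviance_mean_can:
  assumes "\<alpha>\<^sub>1 \<in> A" and "\<alpha>\<^sub>2 \<in> A"
  shows "deviance M f0 A (mean_can M f0 \<alpha>\<^sub>1) (mean_can M f0 \<alpha>\<^sub>2)
    = 2 * ((\<alpha>\<^sub>1 - \<alpha>\<^sub>2) \<bullet> mean_can M f0 \<alpha>\<^sub>1 - (cumulant_gf M f0 \<alpha>\<^sub>1 - cumulant_gf M f0 \<alpha>\<^sub>2))"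
  by (simp add: deviance_def ef_law_mean_can ef_density_mean_can integral_ln_density_can_ratio assms)

end

theorem lemma1:
  fixes M :: "(real^'p) measure" and f0 :: "real^'p \<Rightarrow> real" and A :: "(real^'p) set"
    and \<beta> \<beta>hat :: "real^'p"
  assumes "exponential_family M f0 A"
    and "\<beta>hat \<in> expectation_space M f0 A"
    and "\<beta> \<in> expectation_space M f0 A"
    and "f0 \<beta> > 0"
    and "f0 \<beta>hat > 0"
  shows "conversion_factor M f0 A \<beta>hat \<beta>
           = xi_factor M f0 A \<beta>hat \<beta> * exp (deviance_diff M f0 A \<beta>hat \<beta>)"
proof -
  interpret exponential_family M f0 A by fact
  obtain \<alpha> where \<alpha>: "\<alpha> \<in> A" "\<beta> = mean_can M f0 \<alpha>"
    using assms(3) by (auto simp: expectation_space_def)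
  obtain \<alpha>hat where \<alpha>hat: "\<alpha>hat \<in> A" "\<beta>hat = mean_can M f0 \<alpha>hat"
    using assms(2) by (auto simp: expectation_space_def)
  define \<psi> where "\<psi> = cumulant_gf M f0"
  have density: "ef_density M f0 A \<beta> = density_can M f0 \<alpha>"
    "ef_density M f0 A \<beta>hat = density_can M f0 \<alpha>hat"
    using \<alpha> \<alpha>hat by (simp_all add: ef_density_mean_can)
  \<comment> \<open>Swapping the arguments flips the sign of both the parameter difference and the
    \<psi> difference, so the two halves add up instead of cancelling.\<close>
  have diff: "deviance_diff M f0 A \<beta>hat \<beta>
      = (\<alpha> - \<alpha>hat) \<bullet> (\<beta> + \<beta>hat) - 2 * (\<psi> \<alpha> - \<psi> \<alpha>hat)"
    unfolding deviance_diff_def \<alpha>(2) \<alpha>hat(2)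
      deviance_mean_can[OF \<alpha>(1) \<alpha>hat(1)] deviance_mean_can[OF \<alpha>hat(1) \<alpha>(1)]
    by (simp add: \<psi>_def inner_diff_left inner_add_right field_simps)
  \<comment> \<open>Stated for arbitrary exponents to serve both \<open>conversion_factor\<close>
    and \<open>xi_factor\<close>: each has its numerator evaluated at \<open>\<beta>hat\<close> and
    its denominator at \<open>\<beta>\<close>.\<close>
  have ratio: "exp a * f0 \<beta>hat / (exp b * f0 \<beta>) = exp (a - b) * (f0 \<beta>hat / f0 \<beta>)" for a b
    by (simp add: exp_diff)
  have "conversion_factor M f0 A \<beta>hat \<beta>
      = exp ((\<alpha> \<bullet> \<beta>hat - \<psi> \<alpha>) - (\<alpha>hat \<bullet> \<beta> - \<psi> \<alpha>hat)) * (f0 \<beta>hat / f0 \<beta>)"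
    unfolding conversion_factor_def density density_can_def ratio \<psi>_def ..
  also have "(\<alpha> \<bullet> \<beta>hat - \<psi> \<alpha>) - (\<alpha>hat \<bullet> \<beta> - \<psi> \<alpha>hat)
      = ((\<alpha>hat \<bullet> \<beta>hat - \<psi> \<alpha>hat) - (\<alpha> \<bullet> \<beta> - \<psi> \<alpha>)) + deviance_diff M f0 A \<beta>hat \<beta>"
    unfolding diff by (simp add: inner_diff_left inner_add_right)
  also have "exp \<dots> * (f0 \<beta>hat / f0 \<beta>)
      = xi_factor M f0 A \<beta>hat \<beta> * exp (deviance_diff M f0 A \<beta>hat \<beta>)"
    unfolding xi_factor_def density density_can_def ratio \<psi>_def exp_add by simp
  finally show ?thesis .
qed

end
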